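(* Let $\Delta$ be a $(d-1)$-dimensional simplicial sphere satisfying the link condition such that $\gamma(\Delta)\ge0$. Fix $1\le k\le\frac d2-2$. The limiting inequality (as $d\to+\infty$, with $k$ constant) of the global/averaged lower bound induced by the link condition, $$1-\frac{1}{f_1(\Delta)}\frac{\mathcal C_k}{g_{k+1}(\Delta)}\le f_1(\Delta)^{\frac1k}\,\frac{g_k(\Delta)^{\frac{k+1}{k}}}{g_{k+1}(\Delta)}\left(1-\frac{1}{f_1(\Delta)}\frac{\mathcal C_{k-1}}{g_k(\Delta)}\right)^{\frac{k+1}{k}},$$ holds trivially for $d\gg0$ under the following conditions: (1) Suppose that $d=o(g_1(\Delta))$ (e.g. when $d^2=o(g_2(\Delta))$), and one of the following holds. (1a) There is a constant $0<\mu<1$ such that $$\lim_{d\to+\infty}\frac{g_{k+1}(\Delta)/g_k(\Delta)}{f_1(\Delta)}=\frac{2\mu}{k(k+1)}.$$ Equivalently, we have $$\lim_{d\to+\infty}\frac{g_{k+1}(\Delta)/g_k(\Delta)}{d\,g_1(\Delta)}=\frac{2\mu}{k(k+1)}\quad\text{or}\quad\lim_{d\to+\infty}\frac{g_{k+1}(\Delta)/g_k(\Delta)}{g_2(\Delta)}=\frac{2\mu}{k(k+1)}.$$ (1b) The ratio $\frac{g_{k+1}(\Delta)}{g_k(\Delta)}$ is constant or increases slowly compared to $f_1(\Delta)$ as $d\to+\infty$. More specifically, $\frac{g_{k+1}(\Delta)}{g_k(\Delta)}=o(d\,g_1(\Delta))$ or $\frac{g_{k+1}(\Delta)}{g_k(\Delta)}=o(g_2(\Delta))$.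 (2) The term $g_1(\Delta)$ is (asymptotically) linear in $d$.
   Context: For a $(d-1)$-dimensional simplicial complex $\Delta$, $f_i(\Delta)$ is the number of $i$-dimensional faces ($f_{-1}=1$); $h_j(\Delta)=\sum_{i=0}^j(-1)^{j-i}\binom{d-i}{j-i}f_{i-1}(\Delta)$; $g_0=1$, $g_i=h_i-h_{i-1}$ for $1\le i\le\lfloor d/2\rfloor$. One has $f_1(\Delta)=\binom{d+1}2+d g_1(\Delta)+g_2(\Delta)$. "Simplicial sphere" means PL simplicial sphere. The gamma vector is defined by $\sum_i h_i(\Delta)x^i=\sum_i\gamma_ix^i(1+x)^{d-2i}$; $\gamma(\Delta)\ge0$ means all $\gamma_i\ge0$. The link condition: $\mathrm{lk}_\Delta(a)\cap\mathrm{lk}_\Delta(b)=\mathrm{lk}_\Delta(\{a,b\})$ for every edge $\{a,b\}$, where $\mathrm{lk}_\Delta(F)=\{G\in\Delta:G\cup F\in\Delta,G\cap F=\emptyset\}$. Further $$\mathcal C_k=\sum_{e\in\Delta,|e|=2}g_k(\mathrm{lk}_\Delta(e))=\tfrac12\left[(k+1)(k+2)g_{k+2}(\Delta)+2(k+1)(d-k)g_{k+1}(\Delta)+(d-k)(d-k+1)g_k(\Delta)\right].$$ The displayed inequality comes from averaging over all edges $e$ the $M$-vector condition on the $g$-vectors of the edge contractions $\widetilde\Delta_e$. Its left side lies between 0 and 1, and "holds trivially" means that it imposes no condition for $d\gg0$ because its right side is then at least 1. $\Delta$ is regarded as depending on $d$, and asymptotic notation is with respect to $d\to+\infty$. *)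

theory Defs
  imports "HOL-Analysis.Analysis" "HOL-Analysis.Finite_Function_Topology" "HOL-Library.Landau_Symbols"
begin

section \<open>Abstract simplicial complexes\<close>

definition abstract_complex :: "'a set set \<Rightarrow> bool" where
  "abstract_complex \<Delta> \<longleftrightarrow>
     finite \<Delta> \<and> {} \<in> \<Delta> \<and> (\<forall>F\<in>\<Delta>. finite F) \<and> (\<forall>F\<in>\<Delta>. \<forall>G. G \<subseteq> F \<longrightarrow> G \<in> \<Delta>)"

definition link :: "'a set set \<Rightarrow> 'a set \<Rightarrow> 'a set set" where
  "link \<Delta> F = {G \<in> \<Delta>. G \<union> F \<in> \<Delta> \<and> G \<inter> F = {}}"

definition link_condition :: "'a set set \<Rightarrow> bool" where
  "link_condition \<Delta> \<longleftrightarrow>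
     (\<forall>a b. a \<noteq> b \<and> {a, b} \<in> \<Delta> \<longrightarrow> link \<Delta> {a} \<inter> link \<Delta> {b} = link \<Delta> {a, b})"

definition edges :: "'a set set \<Rightarrow> 'a set set" where
  "edges \<Delta> = {e \<in> \<Delta>. card e = 2}"


section \<open>PL spheres\<close>

text \<open>A geometric simplicial complex is given by the vertex sets of its simplices; the simplex
  with vertex set \<open>\<sigma>\<close> is \<open>convex hull \<sigma>\<close>. (\<open>simplicial_complex\<close> of the theory \<open>Polytope\<close> is
  restricted to a Euclidean space of fixed dimension, which does not fit a family of complexes of
  growing dimension.)\<close>

definition geometric_complex :: "'v::real_vector set set \<Rightarrow> bool" where
  "geometric_complex K \<longleftrightarrow>
     finite K \<and> (\<forall>\<sigma>\<in>K. finite \<sigma> \<and> \<not> affine_dependent \<sigma>) \<and>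
     (\<forall>\<sigma>\<in>K. \<forall>\<tau>. \<tau> \<subseteq> \<sigma> \<longrightarrow> \<tau> \<in> K) \<and>
     (\<forall>\<sigma>\<in>K. \<forall>\<tau>\<in>K. convex hull \<sigma> \<inter> convex hull \<tau> = convex hull (\<sigma> \<inter> \<tau>))"

definition polyhedron_of :: "'v::real_vector set set \<Rightarrow> 'v set" where
  "polyhedron_of K = (\<Union>\<sigma>\<in>K. convex hull \<sigma>)"

definition subdivides :: "'v::real_vector set set \<Rightarrow> 'v set set \<Rightarrow> bool" where
  "subdivides K' K \<longleftrightarrow>
     geometric_complex K' \<and> polyhedron_of K' = polyhedron_of K \<and>
     (\<forall>\<sigma>\<in>K'. \<exists>\<tau>\<in>K. convex hull \<sigma> \<subseteq> convex hull \<tau>)"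

definition affine_map_on :: "'v::real_vector set \<Rightarrow> ('v \<Rightarrow> 'w::real_vector) \<Rightarrow> bool" where
  "affine_map_on S h \<longleftrightarrow>
     (\<forall>x\<in>S. \<forall>y\<in>S. \<forall>t\<in>{0..1}.
        h ((1 - t) *\<^sub>R x + t *\<^sub>R y) = (1 - t) *\<^sub>R h x + t *\<^sub>R h y)"

definition pl_homeomorphic ::
    "'v::real_normed_vector set set \<Rightarrow> 'w::real_normed_vector set set \<Rightarrow> bool" where
  "pl_homeomorphic K L \<longleftrightarrow>
     (\<exists>h h' K'. homeomorphism (polyhedron_of K) (polyhedron_of L) h h' \<and>
        subdivides K' K \<and> (\<forall>\<sigma>\<in>K'. affine_map_on (convex hull \<sigma>) h))"

text \<open>Standard realization: the vertex \<open>v\<close> becomes the unit vector \<open>single v 1\<close> in the normed space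
  \<open>'a \<Rightarrow>\<^sub>0 real\<close> of finitely supported functions on the vertices.\<close>

definition realization :: "'a set set \<Rightarrow> ('a \<Rightarrow>\<^sub>0 real) set set" where
  "realization \<Delta> = (\<lambda>F. (\<lambda>v. Poly_Mapping.single v 1) ` F) ` \<Delta>"

definition simplex_boundary :: "nat \<Rightarrow> nat set set" where
  "simplex_boundary d = {F. F \<subset> {..d}}"

text \<open>The parameter \<open>d\<close> is the dimension plus one, here and in all enumerative invariants below.\<close>

definition pl_sphere :: "nat \<Rightarrow> 'a set set \<Rightarrow> bool" where
  "pl_sphere d \<Delta> \<longleftrightarrow>
     abstract_complex \<Delta> \<and> pl_homeomorphic (realization \<Delta>) (realization (simplex_boundary d))"


section \<open>Face numbers\<close>

definition f_num :: "'a set set \<Rightarrow> int \<Rightarrow> nat" where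
  "f_num \<Delta> i = card {F \<in> \<Delta>. int (card F) = i + 1}"

definition h_num :: "nat \<Rightarrow> 'a set set \<Rightarrow> nat \<Rightarrow> real" where
  "h_num d \<Delta> j =
     (\<Sum>i=0..j. (-1) ^ (j - i) * real ((d - i) choose (j - i)) * real (f_num \<Delta> (int i - 1)))"

definition g_num :: "nat \<Rightarrow> 'a set set \<Rightarrow> nat \<Rightarrow> real" where
  "g_num d \<Delta> i = (if i = 0 then 1 else h_num d \<Delta> i - h_num d \<Delta> (i - 1))"

definition is_gamma_vector :: "nat \<Rightarrow> 'a set set \<Rightarrow> (nat \<Rightarrow> real) \<Rightarrow> bool" where
  "is_gamma_vector d \<Delta> \<gamma> \<longleftrightarrow>
     (\<forall>x::real. (\<Sum>i\<le>d. h_num d \<Delta> i * x ^ i) =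
                (\<Sum>i\<le>d div 2. \<gamma> i * x ^ i * (1 + x) ^ (d - 2 * i)))"

text \<open>The entries \<open>\<gamma> i\<close> with \<open>i \<le> d div 2\<close> are uniquely determined, and they exist for spheres by the
  Dehn--Sommerville relations.\<close>

definition gamma_nonneg :: "nat \<Rightarrow> 'a set set \<Rightarrow> bool" where
  "gamma_nonneg d \<Delta> \<longleftrightarrow> (\<exists>\<gamma>. is_gamma_vector d \<Delta> \<gamma> \<and> (\<forall>i\<le>d div 2. 0 \<le> \<gamma> i))"


section \<open>The averaged lower bound\<close>

text \<open>The link of an edge in a sphere of dimension \<open>d - 1\<close> has dimension \<open>d - 3\<close>, so its
  \<open>g\<close>-numbers are taken with parameter \<open>d - 2\<close>.\<close>

definition C_sum :: "nat \<Rightarrow> 'a set set \<Rightarrow> nat \<Rightarrow> real" where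
  "C_sum d \<Delta> k = (\<Sum>e\<in>edges \<Delta>. g_num (d - 2) (link \<Delta> e) k)"

definition bound_lhs :: "nat \<Rightarrow> 'a set set \<Rightarrow> nat \<Rightarrow> real" where
  "bound_lhs d \<Delta> k = 1 - 1 / real (f_num \<Delta> 1) * (C_sum d \<Delta> k / g_num d \<Delta> (k + 1))"

text \<open>The bracket raised to the power \<open>(k + 1) / k\<close> is the left side for \<open>k - 1\<close>; \<open>k \<ge> 1\<close> throughout.\<close>

definition bound_rhs :: "nat \<Rightarrow> 'a set set \<Rightarrow> nat \<Rightarrow> real" where
  "bound_rhs d \<Delta> k =
     real (f_num \<Delta> 1) powr (1 / real k)
     * (g_num d \<Delta> k powr (real (k + 1) / real k) / g_num d \<Delta> (k + 1))
     * bound_lhs d \<Delta> (k - 1) powr (real (k + 1) / real k)"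

text \<open>The inequality \<open>bound_lhs \<le> bound_rhs\<close> imposes no condition: its left side lies between 0 and 1
  and its right side is at least 1. The first conjunct makes the fractional power in \<open>bound_rhs\<close>
  meaningful.\<close>

definition bound_trivial :: "nat \<Rightarrow> 'a set set \<Rightarrow> nat \<Rightarrow> bool" where
  "bound_trivial d \<Delta> k \<longleftrightarrow>
     0 \<le> bound_lhs d \<Delta> (k - 1) \<and>
     0 \<le> bound_lhs d \<Delta> k \<and> bound_lhs d \<Delta> k \<le> 1 \<and> 1 \<le> bound_rhs d \<Delta> k"

end

theory Submission
  imports Defs "HOL-Real_Asymp.Real_Asymp"
begin

text \<open>Write \<open>n\<^sub>i\<close> for the number of faces with \<open>i\<close> elements. Nonnegativity of the gamma vector gives
  \<open>(d - 2 j - 1) h\<^sub>j \<le> (j + 1) g\<^sub>j\<^sub>+\<^sub>1\<close>. Hence the \<open>g\<^sub>j\<close> grow at least by a factor of order \<open>d\<close>, so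
  that \<open>g\<^sub>k \<le> n\<^sub>k \<le> A g\<^sub>k\<close> with a constant \<open>A\<close> depending only on \<open>k\<close>. Elementary inequalities between face
  counts thus pass to the \<open>g\<close>-numbers: \<open>n\<^sub>k\<^sub>+\<^sub>1 \<le> n\<^sub>1 n\<^sub>k\<close> yields \<open>g\<^sub>k\<^sub>+\<^sub>1 / g\<^sub>k = O(g\<^sub>1)\<close>, and as both \<open>g\<^sub>2\<close> and
  the number of edges are at least of order \<open>d g\<^sub>1\<close>, every limit in (1a) is \<open>0\<close>, so no positive \<open>\<mu>\<close>
  occurs and both sides of each equivalence are false. The formula for \<open>C\<^sub>k\<close> shows moreover that the
  left side of the bound is at least \<open>1/2\<close> for large \<open>d\<close>, and by the Kruskal--Katona inequality
  \<open>n\<^sub>k\<^sub>+\<^sub>1\<^sup>k \<le> n\<^sub>k\<^sup>k\<^sup>+\<^sup>1\<close> the right side is at least a constant times the \<open>k\<close>-th root of the number of edges.\<close>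

section \<open>Face counts and links\<close>

text \<open>Indexing by cardinality shifts the index of \<open>f_num\<close> by one: the edges are
  counted by \<open>face_count D 2\<close>.\<close>

definition face_count :: "'a set set \<Rightarrow> nat \<Rightarrow> nat" where
  "face_count D i = card {F \<in> D. card F = i}"

lemma f_num_eq_face_count: "f_num D (int i - 1) = face_count D i"
  by (simp add: f_num_def face_count_def)

lemma f_num_1: "f_num D 1 = face_count D 2"
  using f_num_eq_face_count[of D 2] by simp

lemma face_count_0:
  assumes "abstract_complex D"
  shows "face_count D 0 = 1"
proof -
  have "{F \<in> D. card F = 0} = {{}}"
    using assms by (auto simp: abstract_complex_def)
  then show ?thesis by (simp add: face_count_def)
qed

lemma abstract_complex_link:
  assumes "abstract_complex D" "G \<in> D"
  shows "abstract_complex (link D G)"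
  unfolding abstract_complex_def
proof (intro conjI ballI allI impI)
  show "finite (link D G)" "{} \<in> link D G"
    using assms by (auto simp: abstract_complex_def link_def)
  show "finite F" if "F \<in> link D G" for F
    using assms that by (auto simp: abstract_complex_def link_def)
  show "F' \<in> link D G" if "F \<in> link D G" "F' \<subseteq> F" for F F'
  proof -
    have "F \<in> D" "F \<union> G \<in> D" "F \<inter> G = {}" using that by (auto simp: link_def)
    moreover have "F' \<union> G \<subseteq> F \<union> G" using that by auto
    ultimately have "F' \<in> D" "F' \<union> G \<in> D" "F' \<inter> G = {}"
      using assms that unfolding abstract_complex_def by blast+
    then show ?thesis by (simp add: link_def)
  qed
qed

lemma face_count_link_le:
  assumes "abstract_complex D"
  shows "face_count (link D G) j \<le> face_count D j"
  unfolding face_count_def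
  using assms by (intro card_mono) (auto simp: abstract_complex_def link_def)

text \<open>Double counting of the pairs \<open>G \<subseteq> H\<close> of faces with
  \<open>card G = r\<close> and \<open>card H = j + r\<close>: a face \<open>F\<close> of the link
  of \<open>G\<close> corresponds to \<open>H = G \<union> F\<close>.\<close>

lemma sum_face_count_link:
  assumes "abstract_complex D"
  shows "(\<Sum>G | G \<in> D \<and> card G = r. face_count (link D G) j) = ((j + r) choose r) * face_count D (j + r)"
proof -
  have fin: "finite D" and finF: "\<And>F. F \<in> D \<Longrightarrow> finite F"
    and sub: "\<And>F G. F \<in> D \<Longrightarrow> G \<subseteq> F \<Longrightarrow> G \<in> D"
    using assms by (auto simp: abstract_complex_def)
  let ?P = "SIGMA G:{G \<in> D. card G = r}. {F \<in> link D G. card F = j}"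
  let ?Q = "SIGMA H:{H \<in> D. card H = j + r}. {G. G \<subseteq> H \<and> card G = r}"
  have "(\<Sum>G | G \<in> D \<and> card G = r. face_count (link D G) j) = card ?P"
    using fin by (subst card_SigmaI) (auto simp: face_count_def link_def)
  also have "bij_betw (\<lambda>(G, F). (G \<union> F, G)) ?P ?Q"
  proof (rule bij_betw_byWitness[where f' = "\<lambda>(H, G). (G, H - G)"])
    show "\<forall>p\<in>?P. (\<lambda>(H, G). (G, H - G)) ((\<lambda>(G, F). (G \<union> F, G)) p) = p"
      by (auto simp: link_def)
    show "\<forall>q\<in>?Q. (\<lambda>(G, F). (G \<union> F, G)) ((\<lambda>(H, G). (G, H - G)) q) = q"
      by auto
    show "(\<lambda>(G, F). (G \<union> F, G)) ` ?P \<subseteq> ?Q"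
      using finF by (auto simp: link_def card_Un_disjoint Int_commute Un_commute)
    show "(\<lambda>(H, G). (G, H - G)) ` ?Q \<subseteq> ?P"
    proof safe
      fix H G assume H: "H \<in> D" "card H = j + card G" "r = card G" and "G \<subseteq> H"
      then show "G \<in> D" "H - G \<in> link D G" "card (H - G) = j"
        using sub[of H G] sub[of H "H - G"] finF[of H]
        by (auto simp: link_def card_Diff_subset finite_subset Un_absorb2)
    qed
  qed
  then have "card ?P = card ?Q" by (rule bij_betw_same_card)
  also have "card ?Q = (\<Sum>H | H \<in> D \<and> card H = j + r. (j + r) choose r)"
    using fin finF by (subst card_SigmaI) (auto simp: n_subsets intro!: sum.cong)
  also have "\<dots> = ((j + r) choose r) * face_count D (j + r)"
    by (simp add: face_count_def)
  finally show ?thesis .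
qed

lemma face_count_Suc_le:
  assumes "abstract_complex D"
  shows "Suc m * face_count D (Suc m) \<le> face_count D 1 * face_count D m"
proof -
  have "Suc m * face_count D (Suc m) = (\<Sum>G | G \<in> D \<and> card G = 1. face_count (link D G) m)"
    using sum_face_count_link[OF assms, where r = 1 and j = m] by simp
  also have "\<dots> \<le> (\<Sum>G | G \<in> D \<and> card G = 1. face_count D m)"
    by (intro sum_mono face_count_link_le[OF assms])
  finally show ?thesis by (simp add: face_count_def)
qed

text \<open>A weak Kruskal--Katona inequality. In the induction step, the links \<open>L\<close> of the vertices satisfy
  both \<open>f\<^sub>m(L) \<le> f\<^sub>m(D)\<close> and the induction hypothesis; a weighted geometric mean of the two bounds is
  linear in \<open>f\<^sub>m\<^sub>-\<^sub>1(L)\<close> and can be summed over the vertices.\<close>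

lemma face_count_Suc_power_le:
  assumes "abstract_complex D"
  shows "face_count D (Suc m) ^ m \<le> face_count D m ^ Suc m"
  using assms
proof (induction m arbitrary: D)
  case 0
  then show ?case by (simp add: face_count_0)
next
  case (Suc m)
  let ?V = "{G \<in> D. card G = 1}"
  define N where "N = real (face_count D (Suc m))"
  \<comment> \<open>This root turns the product \<open>N * ?b ^ Suc m\<close> of the two bounds into
    the power \<open>(t * ?b) ^ Suc m\<close>.\<close>
  define t where "t = root (Suc m) N"
  have N: "N \<ge> 0" and t: "t \<ge> 0" "t ^ Suc m = N"
    using real_root_pow_pos2[of "Suc m" N] by (auto simp: N_def t_def)
  have *: "real (face_count (link D G) (Suc m)) \<le> t * real (face_count (link D G) m)"
    if G: "G \<in> ?V" for G
  proof (rule power_le_imp_le_base)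
    let ?a = "real (face_count (link D G) (Suc m))" and ?b = "real (face_count (link D G) m)"
    have "face_count (link D G) (Suc m) ^ m \<le> face_count (link D G) m ^ Suc m"
      using Suc abstract_complex_link G by blast
    then have "?a ^ m \<le> ?b ^ Suc m"
      by (metis of_nat_le_iff of_nat_power)
    moreover have "?a \<le> N"
      using face_count_link_le[OF Suc.prems] by (simp add: N_def)
    ultimately have "?a * ?a ^ m \<le> N * ?b ^ Suc m"
      using N by (intro mult_mono) auto
    then show "?a ^ Suc m \<le> (t * ?b) ^ Suc m"
      by (simp only: power_mult_distrib t(2)) simp
    show "0 \<le> t * ?b" using t by simp
  qed
  have "real (m + 2) * real (face_count D (Suc (Suc m)))
      = (\<Sum>G\<in>?V. real (face_count (link D G) (Suc m)))"
    using arg_cong[OF sum_face_count_link[OF Suc.prems, where r = 1 and j = "Suc m"], of real]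
    by (simp add: algebra_simps)
  also have "\<dots> \<le> (\<Sum>G\<in>?V. t * real (face_count (link D G) m))"
    by (intro sum_mono *)
  also have "\<dots> = t * (real (Suc m) * N)"
    using arg_cong[OF sum_face_count_link[OF Suc.prems, where r = 1 and j = m], of real]
    by (simp add: N_def sum_distrib_left[symmetric] algebra_simps)
  also have "\<dots> \<le> t * (real (m + 2) * N)"
    using t N by (intro mult_left_mono mult_right_mono) auto
  finally have "real (m + 2) * real (face_count D (Suc (Suc m))) \<le> real (m + 2) * (t * N)"
    by (simp add: algebra_simps)
  then have "real (face_count D (Suc (Suc m))) \<le> t * N"
    by (simp only: mult_le_cancel_left)
  then have "real (face_count D (Suc (Suc m))) ^ Suc m \<le> (t * N) ^ Suc m"
    by (rule power_mono) simp
  also have "\<dots> = N ^ Suc (Suc m)"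
    by (simp only: power_mult_distrib t(2)) simp
  finally show ?case unfolding N_def
    by (metis of_nat_le_iff of_nat_power)
qed


section \<open>The transformation from face counts to \<open>h\<close>-numbers\<close>

text \<open>Stated for arbitrary sequences so that it also applies to face counts summed over
  links.\<close>

definition h_transform :: "nat \<Rightarrow> (nat \<Rightarrow> real) \<Rightarrow> nat \<Rightarrow> real" where
  "h_transform d \<phi> j = (\<Sum>i\<le>j. (-1) ^ (j - i) * real ((d - i) choose (j - i)) * \<phi> i)"

lemma h_num_eq_h_transform: "h_num d D = h_transform d (\<lambda>i. real (face_count D i))"
  by (rule ext) (simp only: h_num_def h_transform_def f_num_eq_face_count atLeast0AtMost)

text \<open>For the face counts of a complex, the left side is the sum of the
  \<open>h\<close>-numbers of the vertex links. The coefficients of each \<open>\<phi> i\<close>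
  agree by the absorption identity \<open>(r + 1) (m choose (r + 1)) = (m - r) (m choose r)\<close>
  with \<open>m = d - i\<close> and \<open>r = j - i\<close>.\<close>

lemma h_transform_derivative:
  assumes "j < d"
  shows "h_transform (d - 1) (\<lambda>i. real (Suc i) * \<phi> (Suc i)) j
       = real (Suc j) * h_transform d \<phi> (Suc j) + real (d - j) * h_transform d \<phi> j"
proof -
  let ?c = "\<lambda>j i. (-1) ^ (j - i) * real ((d - i) choose (j - i))"
  have abs: "real (Suc r) * real (m choose Suc r) = (real m - real r) * real (m choose r)" for m r
  proof (cases "r \<le> m")
    case True
    have "Suc r * (m choose Suc r) = (m - r) * (m choose r)"
      by (simp only: binomial_absorption binomial_absorb_comp)
    then have "real (Suc r) * real (m choose Suc r) = real (m - r) * real (m choose r)"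
      by (metis of_nat_mult)
    then show ?thesis using True by (simp only: of_nat_diff)
  qed (simp add: binomial_eq_0)
  have "real (Suc j) * h_transform d \<phi> (Suc j) + real (d - j) * h_transform d \<phi> j
    = (\<Sum>i\<le>Suc j. real (Suc j) * ?c (Suc j) i * \<phi> i)
      + (\<Sum>i\<le>Suc j. if i \<le> j then real (d - j) * ?c j i * \<phi> i else 0)"
    by (simp add: h_transform_def sum_distrib_left distrib_left mult.assoc)
  also have "\<dots> = (\<Sum>i\<le>Suc j. real i * ?c (Suc j) i * \<phi> i)"
    unfolding sum.distrib[symmetric]
  proof (rule sum.cong)
    fix i assume i: "i \<in> {..Suc j}"
    show "real (Suc j) * ?c (Suc j) i * \<phi> i + (if i \<le> j then real (d - j) * ?c j i * \<phi> i else 0)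
        = real i * ?c (Suc j) i * \<phi> i"
    proof (cases "i \<le> j")
      case True
      have "real (Suc j - i) * real ((d - i) choose (Suc j - i))
          = real (d - j) * real ((d - i) choose (j - i))"
        using abs[of "j - i" "d - i"] True assms by (simp add: Suc_diff_le of_nat_diff)
      moreover have "real (Suc j) = real i + real (Suc j - i)"
        using i by simp
      ultimately have eq: "real (Suc j) * real ((d - i) choose (Suc j - i))
          = real i * real ((d - i) choose (Suc j - i)) + real (d - j) * real ((d - i) choose (j - i))"
        by (simp only: distrib_right)
      show ?thesis using True arg_cong[OF eq, of "\<lambda>x. (-1) ^ (j - i) * \<phi> i * x"]
        by (simp add: Suc_diff_le algebra_simps)
    next
      case False
      then have "i = Suc j" using i by auto
      then show ?thesis by simp
    qed
  qed simp
  also have "\<dots> = (\<Sum>i\<le>j. real (Suc i) * ?c (Suc j) (Suc i) * \<phi> (Suc i))"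
    by (subst sum.atMost_Suc_shift) simp
  also have "\<dots> = h_transform (d - 1) (\<lambda>i. real (Suc i) * \<phi> (Suc i)) j"
    using assms unfolding h_transform_def by (intro sum.cong) (auto simp: mult_ac)
  finally show ?thesis by simp
qed

text \<open>Binomial inversion: after exchanging the sums, \<open>choose_mult\<close> takes
  \<open>(d - l) choose (j - l)\<close> out of the inner sum, and the remaining alternating sum of
  \<open>(j - l) choose r\<close> vanishes unless \<open>l = j\<close>.\<close>

lemma h_transform_inverse:
  assumes "j \<le> d"
  shows "\<phi> j = (\<Sum>i\<le>j. real ((d - i) choose (j - i)) * h_transform d \<phi> i)"
proof -
  have "(\<Sum>i\<le>j. real ((d - i) choose (j - i)) * h_transform d \<phi> i)
    = (\<Sum>i\<le>j. \<Sum>l\<le>i. real ((d - i) choose (j - i)) * ((-1) ^ (i - l) * real ((d - l) choose (i - l)) * \<phi> l))"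
    by (simp add: h_transform_def sum_distrib_left)
  also have "\<dots> = (\<Sum>l\<le>j. \<Sum>i=l..j. real ((d - i) choose (j - i)) * ((-1) ^ (i - l) * real ((d - l) choose (i - l)) * \<phi> l))"
    by (simp add: sum.Sigma) (rule sum.reindex_bij_witness[where i = "\<lambda>(a,b). (b,a)" and j = "\<lambda>(a,b). (b,a)"]; auto)
  also have "\<dots> = (\<Sum>l\<le>j. if l = j then \<phi> j else 0)"
  proof (rule sum.cong)
    fix l assume l: "l \<in> {..j}"
    have "(\<Sum>i=l..j. real ((d - i) choose (j - i)) * ((-1) ^ (i - l) * real ((d - l) choose (i - l)) * \<phi> l))
        = (\<Sum>r\<le>j - l. real ((d - l) choose (j - l)) * \<phi> l * ((-1) ^ r * real ((j - l) choose r)))"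
    proof (rule sum.reindex_bij_witness[where i = "\<lambda>r. l + r" and j = "\<lambda>i. i - l"])
      fix i assume i: "i \<in> {l..j}"
      have "((d - l) choose (i - l)) * ((d - l - (i - l)) choose (j - l - (i - l)))
          = ((d - l) choose (j - l)) * ((j - l) choose (i - l))"
        using i l assms by (intro choose_mult[symmetric]) auto
      then have "real ((d - l) choose (i - l)) * real ((d - i) choose (j - i))
          = real ((d - l) choose (j - l)) * real ((j - l) choose (i - l))"
        using i by (simp flip: of_nat_mult)
      then show "real ((d - l) choose (j - l)) * \<phi> l * ((-1) ^ (i - l) * real ((j - l) choose (i - l)))
        = real ((d - i) choose (j - i)) * ((-1) ^ (i - l) * real ((d - l) choose (i - l)) * \<phi> l)"
        by (simp add: mult_ac)
    qed (use l in auto)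
    also have "\<dots> = real ((d - l) choose (j - l)) * \<phi> l * (\<Sum>r\<le>j - l. (-1) ^ r * real ((j - l) choose r))"
      by (simp add: sum_distrib_left)
    also have "\<dots> = (if l = j then \<phi> j else 0)"
      using l choose_alternating_sum[of "j - l", where 'a = real] by auto
    finally show "(\<Sum>i=l..j. real ((d - i) choose (j - i)) * ((-1) ^ (i - l) * real ((d - l) choose (i - l)) * \<phi> l))
      = (if l = j then \<phi> j else 0)" .
  qed simp
  also have "\<dots> = \<phi> j" by simp
  finally show ?thesis by simp
qed


section \<open>Consequences of the nonnegativity of the gamma vector\<close>

lemma g_num_0: "g_num d D 0 = 1"
  by (simp add: g_num_def)

lemma g_num_Suc: "g_num d D (Suc i) = h_num d D (Suc i) - h_num d D i"
  by (simp add: g_num_def)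

lemma h_num_0:
  assumes "abstract_complex D"
  shows "h_num d D 0 = 1"
  using assms by (simp add: h_num_eq_h_transform h_transform_def face_count_0)

text \<open>Coefficient comparison in the defining identity of the gamma vector. The case
  distinction guards the truncated difference \<open>i - l\<close>.\<close>

lemma h_num_eq_gamma_sum:
  assumes "is_gamma_vector d D \<gamma>" "i \<le> d"
  shows "h_num d D i = (\<Sum>l\<le>d div 2. \<gamma> l * (if l \<le> i then real ((d - 2 * l) choose (i - l)) else 0))"
proof -
  let ?c = "\<lambda>l i. if l \<le> i then real ((d - 2 * l) choose (i - l)) else 0"
  have *: "x ^ l * (1 + x) ^ (d - 2 * l) = (\<Sum>i\<le>d. ?c l i * x ^ i)" if l: "l \<le> d div 2" for l and x :: real
  proof -
    have "x ^ l * (1 + x) ^ (d - 2 * l) = (\<Sum>r\<le>d - 2 * l. real ((d - 2 * l) choose r) * x ^ (l + r))"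
      using binomial_ring[of x 1 "d - 2 * l"]
      by (simp add: add.commute sum_distrib_left power_add mult_ac)
    also have "\<dots> = (\<Sum>i=l..d - l. ?c l i * x ^ i)"
      by (rule sum.reindex_bij_witness[where i = "\<lambda>i. i - l" and j = "\<lambda>r. l + r"]) (use l in auto)
    also have "\<dots> = (\<Sum>i\<le>d. ?c l i * x ^ i)"
      using l by (intro sum.mono_neutral_left) (auto simp: binomial_eq_0)
    finally show ?thesis .
  qed
  have "(\<Sum>i\<le>d. h_num d D i * x ^ i) = (\<Sum>i\<le>d. (\<Sum>l\<le>d div 2. \<gamma> l * ?c l i) * x ^ i)" for x
  proof -
    have "(\<Sum>i\<le>d. h_num d D i * x ^ i) = (\<Sum>l\<le>d div 2. \<gamma> l * (x ^ l * (1 + x) ^ (d - 2 * l)))"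
      using assms by (simp add: is_gamma_vector_def mult.assoc)
    also have "\<dots> = (\<Sum>l\<le>d div 2. \<Sum>i\<le>d. \<gamma> l * ?c l i * x ^ i)"
      by (intro sum.cong) (simp_all only: * sum_distrib_left mult.assoc atMost_iff)
    also have "\<dots> = (\<Sum>i\<le>d. (\<Sum>l\<le>d div 2. \<gamma> l * ?c l i) * x ^ i)"
      by (subst sum.swap) (simp only: sum_distrib_right)
    finally show ?thesis .
  qed
  then have "\<forall>i\<le>d. h_num d D i = (\<Sum>l\<le>d div 2. \<gamma> l * ?c l i)"
    by (subst polyfun_eq_coeffs[symmetric]) blast
  then show ?thesis using assms by blast
qed

text \<open>Summing over edge links amounts to applying \<open>h_transform_derivative\<close> twice,
  where every edge arises from two orderings of its vertices; hence the factor 2. This yields a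
  formula for \<open>h\<close>-numbers, and differences of consecutive indices yield the one for
  \<open>g\<close>-numbers.\<close>

lemma C_sum_eq:
  assumes D: "abstract_complex D" and k: "k + 2 \<le> d"
  shows "2 * C_sum d D k = real ((k + 1) * (k + 2)) * g_num d D (k + 2)
    + 2 * real (k + 1) * (real d - real k) * g_num d D (k + 1)
    + (real d - real k) * (real d - real k + 1) * g_num d D k"
proof -
  define \<phi> where "\<phi> = (\<lambda>i. real (face_count D i))"
  let ?E = "{e \<in> D. card e = 2}"
  let ?h = "h_num d D"
  have h: "2 * (\<Sum>e\<in>?E. h_num (d - 2) (link D e) j)
     = (real j + 1) * ((real j + 2) * ?h (j + 2) + (real d - real j - 1) * ?h (j + 1))
       + (real d - real j - 1) * ((real j + 1) * ?h (j + 1) + (real d - real j) * ?h j)"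
    if j: "j + 2 \<le> d" for j
  proof -
    have "2 * (\<Sum>e\<in>?E. h_num (d - 2) (link D e) j)
       = (\<Sum>i\<le>j. (-1) ^ (j - i) * real ((d - 2 - i) choose (j - i)) *
            (2 * (\<Sum>e\<in>?E. real (face_count (link D e) i))))"
      unfolding h_num_eq_h_transform h_transform_def
      by (subst sum.swap) (simp only: sum_distrib_left mult_ac)
    also have "\<dots> = h_transform (d - 2) (\<lambda>i. real (Suc i) * (real (Suc (Suc i)) * \<phi> (Suc (Suc i)))) j"
      unfolding h_transform_def
    proof (intro sum.cong refl)
      fix i
      have "2 * ((i + 2) choose 2) = Suc i * Suc (Suc i)"
        by (simp add: choose_two)
      then have "2 * (\<Sum>e\<in>?E. face_count (link D e) i) = Suc i * Suc (Suc i) * face_count D (i + 2)"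
        by (simp only: sum_face_count_link[OF D] mult.assoc[symmetric])
      then have "2 * (\<Sum>e\<in>?E. face_count (link D e) i) = Suc i * (Suc (Suc i) * face_count D (Suc (Suc i)))"
        by (simp only: mult.assoc add_2_eq_Suc')
      then have "2 * (\<Sum>e\<in>?E. real (face_count (link D e) i)) = real (Suc i) * (real (Suc (Suc i)) * \<phi> (Suc (Suc i)))"
        unfolding \<phi>_def by (metis (no_types, lifting) of_nat_mult of_nat_numeral of_nat_sum sum.cong)
      then show "(-1) ^ (j - i) * real ((d - 2 - i) choose (j - i)) * (2 * (\<Sum>e\<in>?E. real (face_count (link D e) i)))
        = (-1) ^ (j - i) * real ((d - 2 - i) choose (j - i)) * (real (Suc i) * (real (Suc (Suc i)) * \<phi> (Suc (Suc i))))"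
        by simp
    qed
    also have "\<dots> = real (Suc j) * h_transform (d - 1) (\<lambda>i. real (Suc i) * \<phi> (Suc i)) (Suc j)
        + real (d - 1 - j) * h_transform (d - 1) (\<lambda>i. real (Suc i) * \<phi> (Suc i)) j"
      using h_transform_derivative[of j "d - 1" "\<lambda>i. real (Suc i) * \<phi> (Suc i)"] j
      by (simp add: numeral_2_eq_2)
    also have "\<dots> = real (Suc j) * (real (Suc (Suc j)) * ?h (Suc (Suc j)) + real (d - Suc j) * ?h (Suc j))
        + real (d - 1 - j) * (real (Suc j) * ?h (Suc j) + real (d - j) * ?h j)"
      using j h_transform_derivative[of "Suc j" d \<phi>] h_transform_derivative[of j d \<phi>]
      by (simp add: h_num_eq_h_transform flip: \<phi>_def)
    also have "\<dots> = (real j + 1) * ((real j + 2) * ?h (j + 2) + (real d - real j - 1) * ?h (j + 1))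
       + (real d - real j - 1) * ((real j + 1) * ?h (j + 1) + (real d - real j) * ?h j)"
      using j by (simp add: of_nat_diff algebra_simps)
    finally show ?thesis .
  qed
  show ?thesis
  \<comment> \<open>Index 0 is separate because \<open>g_num\<close> is set to 1 there instead of
    being a difference; this value agrees with \<open>h_num\<close> at 0.\<close>
  proof (cases k)
    case 0
    have "C_sum d D k = (\<Sum>e\<in>?E. h_num (d - 2) (link D e) 0)"
      unfolding C_sum_def edges_def 0
      by (intro sum.cong) (auto simp: g_num_0 h_num_0 abstract_complex_link[OF D])
    moreover have "g_num d D 0 = ?h 0"
      using D by (simp add: g_num_0 h_num_0)
    ultimately show ?thesis
      using h[of 0] k 0
      by (simp add: g_num_Suc numeral_2_eq_2 algebra_simps)
  next
    case (Suc m)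
    have "2 * C_sum d D k = 2 * (\<Sum>e\<in>?E. h_num (d - 2) (link D e) (Suc m))
        - 2 * (\<Sum>e\<in>?E. h_num (d - 2) (link D e) m)"
      by (simp add: C_sum_def edges_def Suc g_num_Suc sum_subtractf)
    also note h[of m]
    also note h[of "Suc m"]
    finally show ?thesis using k
      by (simp add: Suc g_num_Suc algebra_simps)
  qed
qed

text \<open>The factor in \<open>f_le_g\<close>: the 2 comes from \<open>h k \<le> 2 * g k\<close>,
  the powers of \<open>2 * k\<close> from descending from \<open>h k\<close> to \<open>h j\<close>
  by \<open>power_mult_h_le\<close>.\<close>

definition face_const :: "nat \<Rightarrow> real" where
  "face_const k = 2 * (\<Sum>j\<le>k. real (2 * k) ^ (k - j))"

lemma face_const_ge: "face_const k \<ge> 2"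
proof -
  have "(\<Sum>j\<in>{k}. real (2 * k) ^ (k - j)) \<le> (\<Sum>j\<le>k. real (2 * k) ^ (k - j))"
    by (intro sum_mono2) auto
  then show ?thesis by (simp add: face_const_def)
qed

text \<open>The factor of \<open>g 1 * g (k + 1)\<close> in the estimate of
  \<open>2 * C_sum d D k\<close> within \<open>C_sum_le\<close>. The first summand accounts for the
  term with \<open>g (k + 2)\<close>, the second for those with \<open>g (k + 1)\<close> and
  \<open>g k\<close>.\<close>

definition C_const :: "nat \<Rightarrow> real" where
  "C_const k = 4 * face_const (Suc k) * real ((k + 1) * (k + 2)) + 10 * real (k + 1)"

section \<open>Comparison of \<open>h\<close>-, \<open>g\<close>- and face numbers\<close>

locale gamma_nonneg_complex =
  fixes d :: nat and D :: "'a set set"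
  assumes complex: "abstract_complex D"
    and gamma: "gamma_nonneg d D"
begin

abbreviation "f j \<equiv> real (face_count D j)"
abbreviation "h \<equiv> h_num d D"
abbreviation "g \<equiv> g_num d D"

lemma h_nonneg:
  assumes "j \<le> d"
  shows "h j \<ge> 0"
proof -
  obtain \<gamma> where "is_gamma_vector d D \<gamma>" "\<forall>i\<le>d div 2. 0 \<le> \<gamma> i"
    using gamma by (auto simp: gamma_nonneg_def)
  then show ?thesis
    using assms by (auto simp: h_num_eq_gamma_sum intro!: sum_nonneg mult_nonneg_nonneg)
qed

text \<open>It suffices to compare the coefficients of each \<open>\<gamma> l\<close>, where with \<open>n = d - 2 l\<close> and
  \<open>r = j - l\<close> the inequality is
  \<open>(r + 1) ((n choose (r + 1)) - (n choose r)) = (n - 2 r - 1) (n choose r)\<close>.\<close>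

lemma h_le_g_Suc:
  assumes "2 * Suc j \<le> d"
  shows "(real d - 2 * real j - 1) * h j \<le> real (Suc j) * g (Suc j)"
proof -
  obtain \<gamma> where \<gamma>: "is_gamma_vector d D \<gamma>" "\<And>i. i \<le> d div 2 \<Longrightarrow> 0 \<le> \<gamma> i"
    using gamma by (auto simp: gamma_nonneg_def)
  let ?c = "\<lambda>l i. if l \<le> i then real ((d - 2 * l) choose (i - l)) else 0"
  have *: "(real d - 2 * real j - 1) * ?c l j \<le> real (Suc j) * (?c l (Suc j) - ?c l j)" for l
  proof (cases "l \<le> j")
    case True
    define n r where "n = d - 2 * l" and "r = j - l"
    have n: "2 * r + 1 < n" using True assms by (auto simp: n_def r_def)
    have "Suc r * (n choose Suc r) = (n - r) * (n choose r)"
      by (simp only: binomial_absorption binomial_absorb_comp)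
    then have "real (Suc r) * real (n choose Suc r) = real (n - r) * real (n choose r)"
      by (metis of_nat_mult)
    then have eq: "(real n - 2 * real r - 1) * real (n choose r)
        = real (Suc r) * (real (n choose Suc r) - real (n choose r))"
      using n by (simp add: of_nat_diff algebra_simps)
    \<comment> \<open>Replacing the factor \<open>Suc r\<close> by \<open>Suc j\<close> requires
      that the binomial coefficients do not decrease from \<open>r\<close> to
      \<open>Suc r\<close>.\<close>
    have "0 \<le> (real n - 2 * real r - 1) * real (n choose r)"
      using n by (intro mult_nonneg_nonneg) auto
    then have "0 \<le> real (n choose Suc r) - real (n choose r)"
      unfolding eq by (simp add: zero_le_mult_iff)
    then have "real (Suc r) * (real (n choose Suc r) - real (n choose r))
        \<le> real (Suc j) * (real (n choose Suc r) - real (n choose r))"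
      by (intro mult_right_mono) (auto simp: r_def)
    moreover have "real n - 2 * real r = real d - 2 * real j"
      using True assms by (simp add: n_def r_def of_nat_diff)
    ultimately show ?thesis
      using eq True by (simp add: n_def r_def Suc_diff_le)
  qed auto
  have "(real d - 2 * real j - 1) * h j
      = (\<Sum>l\<le>d div 2. \<gamma> l * ((real d - 2 * real j - 1) * ?c l j))"
    using \<gamma> assms by (subst h_num_eq_gamma_sum) (auto simp: sum_distrib_left mult.left_commute)
  also have "\<dots> \<le> (\<Sum>l\<le>d div 2. \<gamma> l * (real (Suc j) * (?c l (Suc j) - ?c l j)))"
    using \<gamma> by (intro sum_mono mult_left_mono *) auto
  also have "\<dots> = real (Suc j) * ((\<Sum>l\<le>d div 2. \<gamma> l * ?c l (Suc j)) - (\<Sum>l\<le>d div 2. \<gamma> l * ?c l j))"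
    by (simp only: sum_distrib_left sum_subtractf[symmetric] right_diff_distrib mult.left_commute)
  also have "\<dots> = real (Suc j) * g (Suc j)"
    using h_num_eq_gamma_sum[OF \<gamma>(1), of j] h_num_eq_gamma_sum[OF \<gamma>(1), of "Suc j"] assms
    by (simp only: g_num_Suc) simp
  finally show ?thesis .
qed

lemma g_le_h:
  assumes "j \<le> d"
  shows "g j \<le> h j"
  using assms h_nonneg complex by (cases j) (auto simp: g_num_0 h_num_0 g_num_Suc)

text \<open>The factor \<open>real d - 2 * real j - 1\<close> in \<open>h_le_g_Suc\<close> is at
  least 1 while \<open>2 * Suc j \<le> d\<close>, so positivity spreads from
  \<open>g 0 = 1\<close>.\<close>

lemma g_pos:
  assumes "2 * j \<le> d"
  shows "g j > 0"
  using assms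
proof (induction j)
  case 0
  then show ?case by (simp add: g_num_0)
next
  case (Suc j)
  have "0 < g j" using Suc by simp
  also have "g j \<le> h j" using Suc by (intro g_le_h) auto
  finally have "0 < (real d - 2 * real j - 1) * h j"
    using Suc.prems by (intro mult_pos_pos) auto
  also have "\<dots> \<le> real (Suc j) * g (Suc j)"
    using Suc by (intro h_le_g_Suc)
  finally show ?case by (simp add: zero_less_mult_iff)
qed

text \<open>The expansion of \<open>f j\<close> through the \<open>h\<close>-numbers has only
  nonnegative terms, one of which is \<open>h j\<close>.\<close>

lemma g_le_f:
  assumes "j \<le> d"
  shows "g j \<le> f j"
proof -
  have "h j = (\<Sum>i\<in>{j}. real ((d - i) choose (j - i)) * h i)" by simp
  also have "\<dots> \<le> (\<Sum>i\<le>j. real ((d - i) choose (j - i)) * h i)"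
    using assms by (intro sum_mono2) (auto intro!: mult_nonneg_nonneg h_nonneg)
  also have "\<dots> = f j"
    using h_transform_inverse[OF assms, of f] by (simp add: h_num_eq_h_transform)
  finally show ?thesis using g_le_h[OF assms] by simp
qed

text \<open>Up to index \<open>k\<close>, the \<open>h\<close>-numbers grow by a factor of at least
  \<open>d / (2 * k)\<close> per step; the powers collect \<open>k - j\<close> such steps.\<close>

lemma power_mult_h_le:
  assumes "4 * k \<le> d" "j \<le> k"
  shows "real d ^ (k - j) * h j \<le> real (2 * k) ^ (k - j) * h k"
  using assms(2)
proof (induction rule: inc_induct)
  case (step j)
  \<comment> \<open>From \<open>j < k\<close> and \<open>4 * k \<le> d\<close> follows
    \<open>4 * j + 2 \<le> d\<close>, so \<open>d\<close> is at most twice the factor in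
    \<open>h_le_g_Suc\<close>.\<close>
  have "real d * h j \<le> 2 * (real d - 2 * real j - 1) * h j"
    using step assms by (intro mult_right_mono h_nonneg) auto
  then have "real d * h j \<le> 2 * ((real d - 2 * real j - 1) * h j)"
    by (simp only: mult.assoc)
  also have "\<dots> \<le> 2 * (real (Suc j) * g (Suc j))"
    using step assms by (intro mult_left_mono h_le_g_Suc) auto
  also have "\<dots> \<le> 2 * (real k * h (Suc j))"
    using step assms g_pos[of "Suc j"] by (intro mult_left_mono mult_mono g_le_h) auto
  finally have *: "real d * h j \<le> real (2 * k) * h (Suc j)" by simp
  have "real d ^ (k - j) * h j = real d ^ (k - Suc j) * (real d * h j)"
    using step by (simp add: Suc_diff_Suc[symmetric])
  also have "\<dots> \<le> real d ^ (k - Suc j) * (real (2 * k) * h (Suc j))"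
    by (intro mult_left_mono *) simp
  also have "\<dots> = real (2 * k) * (real d ^ (k - Suc j) * h (Suc j))"
    by (simp only: mult_ac)
  also have "\<dots> \<le> real (2 * k) * (real (2 * k) ^ (k - Suc j) * h k)"
    using step.IH by (intro mult_left_mono) auto
  also have "\<dots> = real (2 * k) ^ (k - j) * h k"
    using step by (simp add: Suc_diff_Suc[symmetric])
  finally show ?case .
qed simp

text \<open>In the expansion of \<open>f k\<close> through the \<open>h\<close>-numbers, the
  coefficient of \<open>h j\<close> is at most \<open>d ^ (k - j)\<close>, which is the power that
  \<open>power_mult_h_le\<close> absorbs.\<close>

lemma f_le_g:
  assumes "4 * k \<le> d"
  shows "f k \<le> face_const k * g k"
proof -
  have "h k \<le> 2 * g k"
  proof (cases k)
    case 0
    then show ?thesis using complex by (simp add: g_num_0 h_num_0)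
  next
    case (Suc m)
    have "real (Suc m) * h m \<le> (real d - 2 * real m - 1) * h m"
      using assms Suc by (intro mult_right_mono h_nonneg) auto
    also have "\<dots> \<le> real (Suc m) * g (Suc m)"
      using assms Suc by (intro h_le_g_Suc) auto
    finally have "h m \<le> g (Suc m)"
      by (simp only: mult_le_cancel_left)
    then show ?thesis by (simp add: Suc g_num_Suc)
  qed
  then have *: "real (2 * k) ^ (k - j) * h k \<le> real (2 * k) ^ (k - j) * (2 * g k)" for j
    by (intro mult_left_mono) auto
  have "f k = (\<Sum>j\<le>k. real ((d - j) choose (k - j)) * h j)"
    using h_transform_inverse[of k d f] assms by (simp add: h_num_eq_h_transform)
  also have "\<dots> \<le> (\<Sum>j\<le>k. real (2 * k) ^ (k - j) * (2 * g k))"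
  proof (rule sum_mono)
    fix j assume j: "j \<in> {..k}"
    have "(d - j) choose (k - j) \<le> (d - j) ^ (k - j)"
      using j assms by (intro binomial_le_pow) auto
    also have "\<dots> \<le> d ^ (k - j)" by (intro power_mono) auto
    finally have "real ((d - j) choose (k - j)) * h j \<le> real d ^ (k - j) * h j"
      using j assms by (intro mult_right_mono h_nonneg) (auto simp flip: of_nat_power)
    also have "\<dots> \<le> real (2 * k) ^ (k - j) * h k"
      using j assms by (intro power_mult_h_le) auto
    also note *
    finally show "real ((d - j) choose (k - j)) * h j \<le> real (2 * k) ^ (k - j) * (2 * g k)" .
  qed
  also have "\<dots> = face_const k * g k"
    unfolding sum_distrib_right[symmetric] by (simp add: face_const_def)
  finally show ?thesis .
qed

section \<open>Vertices, edges and ratios of \<open>g\<close>-numbers\<close>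

lemma f_1_eq:
  assumes "1 \<le> d"
  shows "f 1 = g 1 + real d + 1"
  using assms complex g_num_Suc[of d D 0]
  by (simp add: h_num_eq_h_transform h_transform_def face_count_0)

lemma g_1_ge:
  assumes "2 \<le> d"
  shows "real d - 1 \<le> g 1"
  using h_le_g_Suc[of 0] assms complex by (simp add: h_num_0)

text \<open>The 4 stems from \<open>d + 1 \<le> 3 * (d - 1)\<close> and
  \<open>d - 1 \<le> g 1\<close>.\<close>

lemma f_1_le:
  assumes "2 \<le> d"
  shows "f 1 \<le> 4 * g 1"
  using f_1_eq g_1_ge assms by simp

text \<open>The detour through face counts costs only constants: \<open>face_count_Suc_le\<close>
  splits off one vertex, then \<open>f_1_le\<close> and \<open>f_le_g\<close> return to
  \<open>g\<close>-numbers.\<close>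

lemma g_Suc_le:
  assumes "4 * k \<le> d" "2 \<le> d"
  shows "g (Suc k) \<le> 4 * face_const k * g 1 * g k"
proof -
  have "g (Suc k) \<le> f (Suc k)"
    using assms by (intro g_le_f) auto
  also have "\<dots> \<le> real (Suc k) * f (Suc k)"
    using mult_right_mono[of 1 "real (Suc k)" "f (Suc k)"] by simp
  also have "\<dots> \<le> f 1 * f k"
    using face_count_Suc_le[OF complex, of k] by (metis of_nat_le_iff of_nat_mult)
  also have "\<dots> \<le> 4 * g 1 * (face_const k * g k)"
    using assms g_1_ge by (intro mult_mono f_1_le f_le_g) auto
  finally show ?thesis by (simp add: mult_ac)
qed

lemma g_2_ge:
  assumes "4 \<le> d"
  shows "(real d - 3) * g 1 \<le> 2 * g 2"
proof -
  have "(real d - 3) * g 1 \<le> (real d - 3) * h 1"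
    using assms by (intro mult_left_mono g_le_h) auto
  also have "\<dots> \<le> 2 * g 2"
    using h_le_g_Suc[of 1] assms by (simp add: numeral_2_eq_2)
  finally show ?thesis .
qed

lemma f_2_ge:
  assumes "4 \<le> d"
  shows "(real d - 3) * g 1 \<le> 2 * f 2"
  using g_2_ge g_le_f[of 2] assms by fastforce

text \<open>There are at most \<open>f 1 ^ 2 / 2\<close> edges, and
  \<open>f 1 \<le> 4 * g 1\<close>. This serves to derive \<open>d = o(g 1)\<close> from
  \<open>d ^ 2 = o(g 2)\<close>.\<close>

lemma g_2_le:
  assumes "2 \<le> d"
  shows "g 2 \<le> 8 * (g 1)\<^sup>2"
proof -
  have "2 * f 2 \<le> f 1 * f 1"
    using face_count_Suc_le[OF complex, of 1]
    by (metis Suc_1 of_nat_le_iff of_nat_mult of_nat_numeral)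
  also have "\<dots> \<le> (4 * g 1) * (4 * g 1)"
    using assms f_1_le g_1_ge by (intro mult_mono) auto
  finally show ?thesis
    using g_le_f[of 2] assms by (simp add: power2_eq_square)
qed

section \<open>The two sides of the averaged bound\<close>

lemma C_sum_nonneg:
  assumes "2 * (k + 2) \<le> d"
  shows "0 \<le> C_sum d D k"
proof -
  have "0 \<le> 2 * C_sum d D k"
    unfolding C_sum_eq[OF complex, of k d, OF le_trans[OF _ assms], simplified]
    using assms g_pos[of k] g_pos[of "k + 1"] g_pos[of "k + 2"]
    by (intro add_nonneg_nonneg mult_nonneg_nonneg) auto
  then show ?thesis by simp
qed

text \<open>Each of the three terms of \<open>C_sum_eq\<close> is at most a constant times
  \<open>g 1 * g (k + 1)\<close>, whereas the number \<open>f 2\<close> of edges is at least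
  \<open>(d - 3) / 2 * g 1\<close>, which outgrows any constant times \<open>g 1\<close>.\<close>

lemma C_sum_le:
  assumes d: "4 * (k + 1) \<le> d" and K: "2 * C_const k + 3 \<le> real d"
  shows "2 * C_sum d D k \<le> f 2 * g (k + 1)"
proof -
  have pos: "g k > 0" "g (k + 1) > 0"
    using d by (auto intro!: g_pos)
  have g1: "real d - 1 \<le> g 1" using d by (intro g_1_ge) auto
  have "real d * g k \<le> 2 * (real d - 2 * real k - 1) * g k"
    using d pos by (intro mult_right_mono) auto
  then have "real d * g k \<le> 2 * ((real d - 2 * real k - 1) * g k)"
    by (simp only: mult.assoc)
  also have "\<dots> \<le> 2 * ((real d - 2 * real k - 1) * h k)"
    using d by (intro mult_left_mono g_le_h) auto
  also have "\<dots> \<le> 2 * (real (k + 1) * g (k + 1))"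
    using h_le_g_Suc[of k] d by simp
  finally have dg: "real d * g k \<le> 2 * (real (k + 1) * g (k + 1))" .
  have "2 * C_sum d D k = real ((k + 1) * (k + 2)) * g (k + 2)
      + 2 * real (k + 1) * (real d - real k) * g (k + 1)
      + (real d - real k) * (real d - real k + 1) * g k"
    using d by (intro C_sum_eq complex) auto
  also have "(real d - real k) * (real d - real k + 1) * g k \<le> real d * (real d + 1) * g k"
    using pos d by (intro mult_right_mono mult_mono) auto
  also have "\<dots> = (real d + 1) * (real d * g k)" by (simp only: mult_ac)
  also have "\<dots> \<le> (real d + 1) * (2 * (real (k + 1) * g (k + 1)))"
    by (intro mult_left_mono dg) auto
  also have "2 * real (k + 1) * (real d - real k) * g (k + 1) \<le> 2 * real (k + 1) * real d * g (k + 1)"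
    using pos by (intro mult_right_mono mult_left_mono) auto
  also have "real ((k + 1) * (k + 2)) * g (k + 2)
      \<le> real ((k + 1) * (k + 2)) * (4 * face_const (Suc k) * g 1 * g (k + 1))"
    using g_Suc_le[of "Suc k"] d by (intro mult_left_mono) auto
  also have "real ((k + 1) * (k + 2)) * (4 * face_const (Suc k) * g 1 * g (k + 1))
      + 2 * real (k + 1) * real d * g (k + 1) + (real d + 1) * (2 * (real (k + 1) * g (k + 1)))
      = (4 * face_const (Suc k) * real ((k + 1) * (k + 2)) * g 1 + real (k + 1) * (4 * real d + 2)) * g (k + 1)"
    by (simp add: algebra_simps)
  \<comment> \<open>The 10 comes from \<open>4 * d + 2 \<le> 10 * (d - 1)\<close> and
    \<open>d - 1 \<le> g 1\<close>.\<close>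
  also have "\<dots> \<le> (4 * face_const (Suc k) * real ((k + 1) * (k + 2)) * g 1 + real (k + 1) * (10 * g 1)) * g (k + 1)"
    using pos d g1 by (intro mult_right_mono add_left_mono mult_left_mono) auto
  also have "\<dots> = C_const k * g 1 * g (k + 1)"
    by (simp add: C_const_def algebra_simps)
  also have "\<dots> \<le> f 2 * g (k + 1)"
  proof (rule mult_right_mono)
    have "2 * C_const k * g 1 \<le> (real d - 3) * g 1"
      using K g1 d by (intro mult_right_mono) auto
    also have "\<dots> \<le> 2 * f 2" using d by (intro f_2_ge) auto
    finally show "C_const k * g 1 \<le> f 2" by simp
  qed (use pos in simp)
  finally show ?thesis by simp
qed

lemma f_2_ge_linear:
  assumes "4 \<le> d"
  shows "real d - 3 \<le> f 2"
proof -
  have "2 * (real d - 3) \<le> (real d - 1) * (real d - 3)"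
    using assms by (intro mult_right_mono) auto
  also have "\<dots> \<le> g 1 * (real d - 3)"
    using assms by (intro mult_right_mono g_1_ge) auto
  also have "\<dots> \<le> 2 * f 2" using f_2_ge assms by (simp add: mult.commute)
  finally show ?thesis by simp
qed

lemma bound_lhs_bounds:
  assumes "4 * (k + 2) \<le> d" "2 * C_const k + 3 \<le> real d"
  shows "1 / 2 \<le> bound_lhs d D k" "bound_lhs d D k \<le> 1"
proof -
  have f2: "f 2 > 0" using f_2_ge_linear assms by auto
  have pos: "g (k + 1) > 0" using assms by (intro g_pos) auto
  have "C_sum d D k \<ge> 0" using assms by (intro C_sum_nonneg) auto
  then show "bound_lhs d D k \<le> 1"
    using f2 pos by (simp add: bound_lhs_def f_num_1)
  have "2 * C_sum d D k \<le> f 2 * g (k + 1)"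
    using assms by (intro C_sum_le) auto
  then show "1 / 2 \<le> bound_lhs d D k"
    using f2 pos by (simp add: bound_lhs_def f_num_1 field_simps)
qed

text \<open>With \<open>A = face_const k\<close> and \<open>p = (k + 1) / k\<close>,
  \<open>face_count_Suc_power_le\<close> and \<open>f_le_g\<close> give
  \<open>g (k + 1) \<le> (A * g k) powr p\<close>. The loss of \<open>A powr p\<close> here and the
  loss of \<open>2 powr p\<close> in the bracket are compensated by the \<open>k\<close>-th root of
  \<open>f 2\<close>, which is at least \<open>(2 * A) powr p\<close>.\<close>

lemma bound_rhs_ge_1:
  assumes k: "1 \<le> k" and d: "4 * (k + 2) \<le> d" and f2: "(2 * face_const k) ^ (k + 1) \<le> f 2"
    and L: "1 / 2 \<le> bound_lhs d D (k - 1)"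
  shows "1 \<le> bound_rhs d D k"
proof -
  define p where "p = real (k + 1) / real k"
  define A where "A = face_const k"
  have A: "A > 0" using face_const_ge[of k] by (simp add: A_def)
  have p: "p \<ge> 0" by (simp add: p_def)
  have pos: "g k > 0" "g (k + 1) > 0"
    using d by (auto intro!: g_pos)
  have root_power: "(x ^ (k + 1)) powr (1 / real k) = x powr p" if "x > 0" for x :: real
    by (simp only: p_def powr_powr powr_realpow[OF that, symmetric] times_divide_eq_right mult_1_right)
  have f_pos: "f k > 0" "f (k + 1) > 0"
    using pos g_le_f[of k] g_le_f[of "k + 1"] d by auto
  have "f (k + 1) ^ k \<le> f k ^ (k + 1)"
    using face_count_Suc_power_le[OF complex, of k]
    by (metis Suc_eq_plus1 of_nat_le_iff of_nat_power)
  then have "(f (k + 1) ^ k) powr (1 / real k) \<le> (f k ^ (k + 1)) powr (1 / real k)"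
    by (intro powr_mono2) auto
  then have "f (k + 1) \<le> f k powr p"
    using f_pos k by (simp only: root_power) (simp add: powr_powr flip: powr_realpow)
  also have "\<dots> \<le> (A * g k) powr p"
    using f_le_g[of k] d p by (intro powr_mono2) (auto simp: A_def)
  also have "\<dots> = A powr p * g k powr p"
    by (intro powr_mult)
  finally have g_le: "g (k + 1) \<le> A powr p * g k powr p"
    using g_le_f[of "k + 1"] d by simp
  have "1 \<le> A powr p * g k powr p / g (k + 1)"
    using g_le pos by simp
  also have "\<dots> = (2 * A) powr p * (g k powr p / g (k + 1)) * (1 / 2) powr p"
    using A by (simp add: powr_mult powr_divide)
  also have "\<dots> \<le> f 2 powr (1 / real k) * (g k powr p / g (k + 1)) * bound_lhs d D (k - 1) powr p"
  proof (intro mult_mono powr_mono2 L p)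
    have "(2 * A) powr p = ((2 * A) ^ (k + 1)) powr (1 / real k)"
      using A by (simp only: root_power)
    also have "\<dots> \<le> f 2 powr (1 / real k)"
      using f2 A by (intro powr_mono2) (auto simp: A_def)
    finally show "(2 * A) powr p \<le> f 2 powr (1 / real k)" .
  qed (use pos in auto)
  also have "\<dots> = bound_rhs d D k"
    by (simp add: bound_rhs_def p_def f_num_1)
  finally show ?thesis .
qed

lemma bound_trivial:
  assumes "1 \<le> k" "4 * (k + 2) \<le> d" "2 * C_const k + 3 \<le> real d" "2 * C_const (k - 1) + 3 \<le> real d"
    and "(2 * face_const k) ^ (k + 1) + 3 \<le> real d"
  shows "bound_trivial d D k"
proof -
  have "(2 * face_const k) ^ (k + 1) \<le> f 2"
    using f_2_ge_linear assms by auto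
  moreover have "1 / 2 \<le> bound_lhs d D (k - 1)"
    using assms by (intro bound_lhs_bounds) auto
  ultimately show ?thesis
    using assms bound_lhs_bounds[of k] bound_rhs_ge_1[of k]
    by (simp add: bound_trivial_def)
qed

end

section \<open>Families of spheres as \<open>d\<close> tends to infinity\<close>

theorem corollary2p46:
  fixes \<Delta> :: "nat \<Rightarrow> 'a set set" and k :: nat
  assumes "1 \<le> k"
    and "\<And>d. real k \<le> real d / 2 - 2 \<Longrightarrow> pl_sphere d (\<Delta> d)"
    and "\<And>d. real k \<le> real d / 2 - 2 \<Longrightarrow> link_condition (\<Delta> d)"
    and "\<And>d. real k \<le> real d / 2 - 2 \<Longrightarrow> gamma_nonneg d (\<Delta> d)"
  shows
    \<comment> \<open>the example in (1)\<close>
    "((\<lambda>d. real d ^ 2) \<in> o(\<lambda>d. g_num d (\<Delta> d) 2)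
        \<longrightarrow> (\<lambda>d. real d) \<in> o(\<lambda>d. g_num d (\<Delta> d) 1))
     \<and>
     \<comment> \<open>the equivalent forms of the limit condition in (1a)\<close>
     ((\<lambda>d. real d) \<in> o(\<lambda>d. g_num d (\<Delta> d) 1) \<longrightarrow>
       (\<forall>\<mu>::real. 0 < \<mu> \<and> \<mu> < 1 \<longrightarrow>
         ((\<lambda>d. g_num d (\<Delta> d) (k + 1) / g_num d (\<Delta> d) k / real (f_num (\<Delta> d) 1))
            \<longlonglongrightarrow> 2 * \<mu> / (real k * (real k + 1))
          \<longleftrightarrow> (\<lambda>d. g_num d (\<Delta> d) (k + 1) / g_num d (\<Delta> d) k / (real d * g_num d (\<Delta> d) 1))
            \<longlonglongrightarrow> 2 * \<mu> / (real k * (real k + 1)))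
         \<and>
         ((\<lambda>d. g_num d (\<Delta> d) (k + 1) / g_num d (\<Delta> d) k / real (f_num (\<Delta> d) 1))
            \<longlonglongrightarrow> 2 * \<mu> / (real k * (real k + 1))
          \<longleftrightarrow> (\<lambda>d. g_num d (\<Delta> d) (k + 1) / g_num d (\<Delta> d) k / g_num d (\<Delta> d) 2)
            \<longlonglongrightarrow> 2 * \<mu> / (real k * (real k + 1)))))
     \<and>
     \<comment> \<open>the main claim, under (1) with (1a) or (1b), or under (2)\<close>
     (((\<lambda>d. real d) \<in> o(\<lambda>d. g_num d (\<Delta> d) 1) \<and>
         ((\<exists>\<mu>::real. 0 < \<mu> \<and> \<mu> < 1 \<and>
             (\<lambda>d. g_num d (\<Delta> d) (k + 1) / g_num d (\<Delta> d) k / real (f_num (\<Delta> d) 1))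
               \<longlonglongrightarrow> 2 * \<mu> / (real k * (real k + 1)))
          \<or> (\<lambda>d. g_num d (\<Delta> d) (k + 1) / g_num d (\<Delta> d) k)
               \<in> o(\<lambda>d. real d * g_num d (\<Delta> d) 1)
          \<or> (\<lambda>d. g_num d (\<Delta> d) (k + 1) / g_num d (\<Delta> d) k)
               \<in> o(\<lambda>d. g_num d (\<Delta> d) 2))
       \<or> (\<lambda>d. g_num d (\<Delta> d) 1) \<in> \<Theta>(\<lambda>d. real d))
      \<longrightarrow> (\<forall>\<^sub>F d in sequentially. bound_trivial d (\<Delta> d) k))"
proof -
  let ?g = "\<lambda>d. g_num d (\<Delta> d)" and ?f = "\<lambda>d. real (f_num (\<Delta> d) 1)"
  let ?R = "\<lambda>d. ?g d (k + 1) / ?g d k"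
  define A where "A = face_const k"
  have A: "A > 0" using face_const_ge[of k] by (simp add: A_def)
  have loc: "gamma_nonneg_complex d (\<Delta> d)" if "4 * (k + 2) \<le> d" for d
  proof -
    have "real k \<le> real d / 2 - 2" using that by simp
    then show ?thesis
      using assms(2,4)[of d] by (simp add: gamma_nonneg_complex_def pl_sphere_def)
  qed
  note bound_trivial_d = gamma_nonneg_complex.bound_trivial[OF loc]
  have ev: "\<forall>\<^sub>F d in sequentially. 4 * (k + 2) \<le> d"
    by (rule eventually_ge_at_top)

  have A_part: "(\<lambda>d. real d) \<in> o(\<lambda>d. ?g d 1)" if o: "(\<lambda>d. real d ^ 2) \<in> o(\<lambda>d. ?g d 2)"
  proof (rule landau_o.smallI)
    fix c :: real assume c: "c > 0"
    \<comment> \<open>The constant \<open>c\<^sup>2 / 8\<close> is chosen so that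
      \<open>g_2_le\<close> turns the bound into the square of \<open>c * ?g d 1\<close>.\<close>
    have "\<forall>\<^sub>F d in sequentially. norm (real d ^ 2) \<le> c\<^sup>2 / 8 * norm (?g d 2)"
      using c by (intro landau_o.smallD[OF o]) simp
    with ev show "\<forall>\<^sub>F d in sequentially. norm (real d) \<le> c * norm (?g d 1)"
    proof eventually_elim
      case (elim d)
      interpret gamma_nonneg_complex d "\<Delta> d" using elim by (intro loc)
      have pos: "?g d 1 > 0" "?g d 2 > 0" using elim by (auto intro!: g_pos)
      have "real d ^ 2 \<le> c\<^sup>2 / 8 * ?g d 2" using elim pos by simp
      also have "\<dots> \<le> c\<^sup>2 / 8 * (8 * (?g d 1)\<^sup>2)"
        using elim by (intro mult_left_mono g_2_le) auto
      also have "\<dots> = (c * ?g d 1)\<^sup>2" by (simp add: power_mult_distrib)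
      finally show ?case using c pos by (simp add: power2_le_iff_abs_le)
    qed
  qed

  \<comment> \<open>All three denominators are at least \<open>(d - 3) / 2 * ?g d 1\<close>, whereas
    \<open>g_Suc_le\<close> bounds the ratio \<open>?R d\<close> by
    \<open>4 * A * ?g d 1\<close>.\<close>
  have R_bounds: "\<forall>\<^sub>F d in sequentially. 0 \<le> ?R d / ?f d \<and> ?R d / ?f d \<le> 8 * A / (real d - 3)
      \<and> 0 \<le> ?R d / (real d * ?g d 1) \<and> ?R d / (real d * ?g d 1) \<le> 8 * A / (real d - 3)
      \<and> 0 \<le> ?R d / ?g d 2 \<and> ?R d / ?g d 2 \<le> 8 * A / (real d - 3)"
    using ev
  proof eventually_elim
    case (elim d)
    interpret gamma_nonneg_complex d "\<Delta> d" using elim by (intro loc)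
    have pos: "?g d 1 > 0" "?g d k > 0" "?g d (k + 1) > 0"
      using elim by (auto intro!: g_pos)
    have "?g d (k + 1) \<le> 4 * A * ?g d 1 * ?g d k"
      using g_Suc_le[of k] elim by (simp add: A_def)
    then have R: "0 \<le> ?R d" "?R d \<le> 4 * A * ?g d 1"
      using pos by (auto simp: pos_divide_le_eq)
    have cross: "u / x \<le> v / y" if "0 < x" "0 < y" "u * y \<le> v * x" for x y u v :: real
      using that by (simp add: divide_simps)
    have *: "0 \<le> ?R d / x \<and> ?R d / x \<le> 8 * A / (real d - 3)" if x: "(real d - 3) * ?g d 1 \<le> 2 * x" for x
    proof -
      have "0 < (real d - 3) * ?g d 1" using elim pos by (intro mult_pos_pos) auto
      then have "x > 0" using x by simp
      have "?R d * (real d - 3) \<le> 4 * A * ?g d 1 * (real d - 3)"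
        using R elim by (intro mult_right_mono) auto
      also have "\<dots> \<le> 4 * A * (2 * x)"
        using A x by (simp only: mult.assoc mult.commute[of "?g d 1"]) (intro mult_left_mono, auto)
      finally have "?R d / x \<le> 8 * A / (real d - 3)"
        using cross[of x "real d - 3" "?R d" "8 * A"] \<open>x > 0\<close> elim by simp
      then show ?thesis using divide_nonneg_pos[OF R(1) \<open>x > 0\<close>] by blast
    qed
    have "(real d - 3) * ?g d 1 \<le> 2 * real d * ?g d 1"
      using pos by (intro mult_right_mono) auto
    then have "(real d - 3) * ?g d 1 \<le> 2 * (real d * ?g d 1)" by (simp only: mult.assoc)
    then show ?case
      using *[of "?f d"] *[of "real d * ?g d 1"] *[of "?g d 2"] f_2_ge g_2_ge elim
      by (simp add: f_num_1)
  qed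
  have squeeze: "X \<longlonglongrightarrow> 0"
    if "\<forall>\<^sub>F d in sequentially. 0 \<le> X d \<and> X d \<le> 8 * A / (real d - 3)" for X
  proof (rule tendsto_sandwich[OF _ _ tendsto_const])
    show "(\<lambda>d. 8 * A / (real d - 3)) \<longlonglongrightarrow> 0" by real_asymp
  qed (use that in \<open>auto elim: eventually_mono\<close>)
  have lim0: "(\<lambda>d. ?R d / ?f d) \<longlonglongrightarrow> 0" "(\<lambda>d. ?R d / (real d * ?g d 1)) \<longlonglongrightarrow> 0"
      "(\<lambda>d. ?R d / ?g d 2) \<longlonglongrightarrow> 0"
    by (rule squeeze, rule eventually_mono[OF R_bounds], blast)+
  have not_lim: "\<not> X \<longlonglongrightarrow> 2 * \<mu> / (real k * (real k + 1))" if "X \<longlonglongrightarrow> 0" "0 < \<mu>" for X \<mu>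
    using LIMSEQ_unique[OF that(1)] that(2) assms(1) by fastforce

  \<comment> \<open>The lower bounds on \<open>d\<close> in \<open>bound_trivial_d\<close> depend
    only on \<open>k\<close>, so they hold eventually along the family.\<close>
  have trivial: "\<forall>\<^sub>F d in sequentially. bound_trivial d (\<Delta> d) k"
  proof -
    have large: "\<forall>\<^sub>F d in sequentially. c \<le> real d" for c
      using filterlim_real_sequentially by (auto simp: filterlim_at_top)
    show ?thesis
      using ev large[of "2 * C_const k + 3"] large[of "2 * C_const (k - 1) + 3"]
        large[of "(2 * face_const k) ^ (k + 1) + 3"]
      by eventually_elim (use bound_trivial_d assms(1) in auto)
  qed

  \<comment> \<open>The equivalences follow because \<open>not_lim\<close> refutes both sides of
    each.\<close>
  show ?thesis
    using A_part trivial not_lim[OF lim0(1)] not_lim[OF lim0(2)] not_lim[OF lim0(3)] by blast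
qed

end
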